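(* Let $m\ge 1$ and let $V:S^{m-1}\to S^{m-1}$ be a dissipative quadratic stochastic operator. Then $V$ is ergodic, i.e. for every $x\in S^{m-1}$ the limit $$\lim_{n\to\infty}\frac{x+Vx+\cdots+V^{n-1}x}{n}$$ exists.
   Context: $S^{m-1}=\{x\in\mathbb{R}^m: x_i\ge 0,\ \sum_{i=1}^m x_i=1\}$. A quadratic stochastic operator (q.s.o.) is a map $V:S^{m-1}\to S^{m-1}$ of the form $(Vx)_k=\sum_{i,j=1}^m p_{ij,k}x_ix_j$, $k=1,\dots,m$, where $p_{ij,k}=p_{ji,k}\ge 0$ and $\sum_{k=1}^m p_{ij,k}=1$ for all $i,j$. For $x\in\mathbb{R}^m$, let $x_{\downarrow}=(x_{[1]},\dots,x_{[m]})$ denote the decreasing rearrangement of $x$ ($x_{[1]}\ge\cdots\ge x_{[m]}$). For $x,y\in\mathbb{R}^m$, write $x\prec y$ (equivalently $y\succ x$) if $\sum_{i=1}^k x_{[i]}\le\sum_{i=1}^k y_{[i]}$ for $k=1,\dots,m-1$ and $\sum_{i=1}^m x_{[i]}=\sum_{i=1}^m y_{[i]}$. An operator $V:S^{m-1}\to S^{m-1}$ is dissipative if $Vx\succ x$ for all $x\in S^{m-1}$. $V^n$ denotes the $n$-th iterate of $V$. *)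

theory Defs
  imports "HOL-Analysis.Analysis" "HOL-Library.Multiset"
begin

text \<open>The simplex \<open>S\<^sup>m\<^sup>-\<^sup>1\<close>, with coordinates indexed by the finite type \<open>'m\<close>, so that
  \<open>m = CARD('m) \<ge> 1\<close>.\<close>

definition prob_simplex :: "(real ^ 'm) set" where
  "prob_simplex = {x. (\<forall>i. 0 \<le> x $ i) \<and> (\<Sum>i\<in>UNIV. x $ i) = 1}"

text \<open>Operators on the simplex are total functions on \<open>real ^ 'm\<close>; their values outside
  \<open>prob_simplex\<close> are left unconstrained.\<close>

definition quadratic_stochastic_operator :: "(real ^ 'm \<Rightarrow> real ^ 'm) \<Rightarrow> bool" where
  "quadratic_stochastic_operator V \<longleftrightarrow>
     V \<in> prob_simplex \<rightarrow> prob_simplex \<and>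
     (\<exists>p :: 'm \<Rightarrow> 'm \<Rightarrow> 'm \<Rightarrow> real.
        (\<forall>i j k. p i j k = p j i k \<and> p i j k \<ge> 0) \<and>
        (\<forall>i j. (\<Sum>k\<in>UNIV. p i j k) = 1) \<and>
        (\<forall>x\<in>prob_simplex. \<forall>k. V x $ k = (\<Sum>i\<in>UNIV. \<Sum>j\<in>UNIV. p i j k * x $ i * x $ j)))"

text \<open>Since list positions start at 0, the entry \<open>x\<^bsub>[i]\<^esub>\<close> is \<open>decreasing_rearrangement x ! (i - 1)\<close>.\<close>

definition decreasing_rearrangement :: "real ^ 'm \<Rightarrow> real list" where
  "decreasing_rearrangement x =
     rev (sorted_list_of_multiset (image_mset (\<lambda>i. x $ i) (mset_set UNIV)))"

definition majorized_by :: "real ^ 'm \<Rightarrow> real ^ 'm \<Rightarrow> bool"  (infix \<open>\<prec>\<^sub>m\<close> 50) where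
  "x \<prec>\<^sub>m y \<longleftrightarrow>
     (\<forall>k\<in>{1..CARD('m) - 1}.
        (\<Sum>i=1..k. decreasing_rearrangement x ! (i - 1))
          \<le> (\<Sum>i=1..k. decreasing_rearrangement y ! (i - 1))) \<and>
     (\<Sum>i=1..CARD('m). decreasing_rearrangement x ! (i - 1))
       = (\<Sum>i=1..CARD('m). decreasing_rearrangement y ! (i - 1))"

definition dissipative :: "(real ^ 'm \<Rightarrow> real ^ 'm) \<Rightarrow> bool" where
  "dissipative V \<longleftrightarrow> (\<forall>x\<in>prob_simplex. x \<prec>\<^sub>m V x)"

definition ergodic :: "(real ^ 'm \<Rightarrow> real ^ 'm) \<Rightarrow> bool" where
  "ergodic V \<longleftrightarrow>
     (\<forall>x\<in>prob_simplex. convergent (\<lambda>n. (\<Sum>i<n. (V ^^ i) x) /\<^sub>R real n))"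

lemma length_decreasing_rearrangement:
  "length (decreasing_rearrangement (x :: real ^ 'm)) = CARD('m)"
  by (metis decreasing_rearrangement_def length_rev mset_sorted_list_of_multiset size_image_mset
      size_mset size_mset_set)

lemma sorted_decreasing_rearrangement:
  "sorted_wrt (\<ge>) (decreasing_rearrangement x)"
  by (simp add: decreasing_rearrangement_def sorted_wrt_rev)

lemma mset_decreasing_rearrangement:
  "mset (decreasing_rearrangement x) = image_mset (\<lambda>i. x $ i) (mset_set UNIV)"
  by (simp add: decreasing_rearrangement_def)

end

theory Submission
  imports Defs "HOL-Combinatorics.Permutations"
begin

text \<open>
  Dissipativity makes the partial sums of the decreasing rearrangement monotone along an orbit
  \<open>y n = V\<^sup>n x\<close>, so the rearrangements converge, say to \<open>a\<close>. Permuting \<open>a\<close> in the way the entries of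
  \<open>y n\<close> are ordered yields a sequence \<open>z\<close> with finitely many values and \<open>y n - z n \<longrightarrow> 0\<close>. By uniform
  continuity \<open>z (n + 1) - V (z n) \<longrightarrow> 0\<close>, and as only finitely many values occur, eventually
  \<open>z (n + 1) = V (z n)\<close>. Hence \<open>z\<close> is eventually periodic, and the orbit has the same Cesaro limit.
  Of \<open>V\<close> being quadratic only its continuity matters.
\<close>

section \<open>Cesaro means of null and of eventually periodic sequences\<close>

lemma null_sequence_means:
  fixes w :: "nat \<Rightarrow> 'a::real_normed_vector"
  assumes "w \<longlonglongrightarrow> 0"
  shows "(\<lambda>n. (\<Sum>i<n. w i) /\<^sub>R real n) \<longlonglongrightarrow> 0"
proof (rule LIMSEQ_I)
  fix r :: real
  assume r: "r > 0"
  obtain N where N: "\<And>i. i \<ge> N \<Longrightarrow> norm (w i) < r / 2"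
    using LIMSEQ_D[OF assms, of "r / 2"] r by auto
  define C where "C = (\<Sum>i<N. norm (w i))"
  \<comment> \<open>Past \<open>N\<close> the terms contribute at most \<open>r / 2\<close> to the
    mean; \<open>M\<close> is large enough that the fixed initial sum \<open>C\<close> contributes
    less than \<open>r / 2\<close>.\<close>
  obtain M :: nat where M: "real M > 2 * C / r"
    using reals_Archimedean2 by blast
  have "norm ((\<Sum>i<n. w i) /\<^sub>R real n - 0) < r" if n: "n \<ge> max N (max M 1)" for n
  proof -
    have "norm (\<Sum>i<n. w i) \<le> (\<Sum>i<n. norm (w i))"
      by (rule norm_sum)
    also have "\<dots> = C + (\<Sum>i=N..<n. norm (w i))"
      using n unfolding C_def by (simp add: lessThan_atLeast0 sum.atLeastLessThan_concat)
    also have "(\<Sum>i=N..<n. norm (w i)) \<le> real (card {N..<n}) * (r / 2)"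
      by (rule sum_bounded_above) (meson N atLeastLessThan_iff less_imp_le)
    also have "\<dots> \<le> real n * (r / 2)"
      using r by (intro mult_right_mono) auto
    finally have le: "norm (\<Sum>i<n. w i) \<le> C + real n * (r / 2)"
      by simp
    have "2 * C / r < real n"
      using M n by linarith
    then have "C < real n * (r / 2)"
      using r by (simp add: field_simps)
    with le have "norm (\<Sum>i<n. w i) < real n * r"
      by simp
    then show ?thesis
      using n by (simp add: divide_simps mult.commute)
  qed
  then show "\<exists>no. \<forall>n\<ge>no. norm ((\<Sum>i<n. w i) /\<^sub>R real n - 0) < r"
    by blast
qed

text \<open>The sum over a window of \<open>p\<close> consecutive terms is eventually a constant
  \<open>c\<close>, so partial sums differ from a linear function of slope \<open>c / p\<close> by a
  bounded amount. The means therefore tend to \<open>c / p\<close>.\<close>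

lemma eventually_periodic_means_convergent:
  fixes z :: "nat \<Rightarrow> 'a::real_normed_vector"
  assumes "p > 0" and per: "\<And>n. n \<ge> N \<Longrightarrow> z (n + p) = z n"
  shows "convergent (\<lambda>n. (\<Sum>i<n. z i) /\<^sub>R real n)"
proof -
  define S where "S n = (\<Sum>i<n. z i)" for n
  define c where "c = S (N + p) - S N"
  have window: "S (n + p) - S n = c" if "n \<ge> N" for n
    using that
  proof (induction n rule: dec_induct)
    case base
    show ?case by (simp add: c_def)
  next
    case (step n)
    then show ?case using per[of n] by (simp add: S_def)
  qed
  \<comment> \<open>Removing the linear growth leaves an eventually periodic sequence; it has
    finitely many values and is therefore bounded.\<close>
  define D where "D n = S n - (real n / real p) *\<^sub>R c" for n
  have D_per: "D (n + p) = D n" if "n \<ge> N" for n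
    using window[OF that] \<open>p > 0\<close>
    by (simp add: D_def algebra_simps add_divide_distrib)
  have D_in: "D n \<in> D ` {..<N + p}" for n
  proof (induction n rule: less_induct)
    case (less n)
    show ?case
    proof (cases "n < N + p")
      case False
      then have "D n = D (n - p)"
        using D_per[of "n - p"] by simp
      then show ?thesis
        using less[of "n - p"] \<open>p > 0\<close> False by simp
    qed auto
  qed
  then have "bounded (range D)"
    by (intro finite_imp_bounded finite_subset[of "range D" "D ` {..<N + p}"]) auto
  then obtain B where B: "\<And>n. norm (D n) \<le> B"
    by (auto simp: bounded_iff)
  have "(\<lambda>n. D n /\<^sub>R real n) \<longlonglongrightarrow> 0"
  proof (rule Lim_null_comparison)
    show "\<forall>\<^sub>F n in sequentially. norm (D n /\<^sub>R real n) \<le> B / real n"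
      using B by (intro always_eventually) (simp add: divide_inverse_commute mult_left_mono)
    show "(\<lambda>n. B / real n) \<longlonglongrightarrow> 0"
      by (rule lim_const_over_n)
  qed
  then have "(\<lambda>n. D n /\<^sub>R real n + (1 / real p) *\<^sub>R c) \<longlonglongrightarrow> 0 + (1 / real p) *\<^sub>R c"
    by (intro tendsto_intros)
  moreover have "\<forall>\<^sub>F n in sequentially.
      D n /\<^sub>R real n + (1 / real p) *\<^sub>R c = (\<Sum>i<n. z i) /\<^sub>R real n"
    \<comment> \<open>The identity needs \<open>n > 0\<close>: at \<open>n = 0\<close> the right
      side is 0 by division by zero, while the left side is \<open>c / p\<close>.\<close>
    using eventually_gt_at_top[of 0]
    by eventually_elim (simp add: D_def S_def scaleR_diff_right field_simps)
  ultimately show ?thesis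
    by (intro convergentI) (rule Lim_transform_eventually)
qed

section \<open>Orbits asymptotic to a finite set\<close>

text \<open>By the pigeonhole principle some value recurs after \<open>N\<close>, and the recursion
  propagates this coincidence to all later indices.\<close>

lemma eventually_recursive_imp_eventually_periodic:
  fixes z :: "nat \<Rightarrow> 'a"
  assumes "finite F" and "\<And>n. z n \<in> F" and rec: "\<And>n. n \<ge> N \<Longrightarrow> z (Suc n) = f (z n)"
  obtains p M where "p > 0" "\<And>n. n \<ge> M \<Longrightarrow> z (n + p) = z n"
proof -
  have "finite (z ` {N..})"
    using assms(1,2) by (meson finite_subset image_subsetI)
  then have "\<not> inj_on z {N..}"
    using finite_imageD infinite_Ici by blast
  then obtain i j where ij: "i \<ge> N" "i < j" "z i = z j"
    unfolding inj_on_def by (metis atLeast_iff linorder_neqE_nat)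
  have "z (n + (j - i)) = z n" if "n \<ge> i" for n
    using that
  proof (induction n rule: dec_induct)
    case base
    show ?case using ij by simp
  next
    case (step n)
    then show ?case using rec[of n] rec[of "n + (j - i)"] ij by simp
  qed
  then show thesis
    using that[of "j - i" i] ij by simp
qed

lemma orbit_near_finite_set_means_convergent:
  fixes f :: "'a::real_normed_vector \<Rightarrow> 'a"
  assumes "compact K" and "continuous_on K f"
    and y: "\<And>n. y n \<in> K" "\<And>n. y (Suc n) = f (y n)"
    and F: "finite F" "F \<subseteq> K" "\<And>n. z n \<in> F"
    and lim: "(\<lambda>n. y n - z n) \<longlonglongrightarrow> 0"
  shows "convergent (\<lambda>n. (\<Sum>i<n. y i) /\<^sub>R real n)"
proof -
  have "uniformly_continuous_on K f"
    using assms(1,2) by (rule compact_uniformly_continuous[rotated])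
  moreover have zK: "z n \<in> K" for n
    using F by blast
  ultimately have "(\<lambda>n. dist (f (y n)) (f (z n))) \<longlonglongrightarrow> 0"
    using y(1) lim unfolding uniformly_continuous_on_sequentially
    by (simp add: dist_norm tendsto_norm_zero_iff)
  then have "(\<lambda>n. f (y n) - f (z n)) \<longlonglongrightarrow> 0"
    by (simp add: dist_norm tendsto_norm_zero_iff)
  from tendsto_diff[OF this LIMSEQ_Suc[OF lim]]
  have step: "(\<lambda>n. z (Suc n) - f (z n)) \<longlonglongrightarrow> 0"
    by (simp add: y(2))
  \<comment> \<open>All defects \<open>z (Suc n) - f (z n)\<close> lie in this finite set, whichever
    points of \<open>F\<close> the sequence visits.\<close>
  define G where "G = (\<lambda>(u, v). u - f v) ` (F \<times> F)"
  have "finite G"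
    using F(1) by (simp add: G_def)
  \<comment> \<open>The nonzero elements of \<open>G\<close> stay away from 0, so a null sequence
    with values in \<open>G\<close> is eventually equal to 0.\<close>
  then have "open (- (G - {0}))"
    by (intro open_Compl finite_imp_closed) simp
  then have "\<forall>\<^sub>F n in sequentially. z (Suc n) - f (z n) \<in> - (G - {0})"
    by (rule topological_tendstoD[OF step]) simp
  moreover have "z (Suc n) - f (z n) \<in> G" for n
    unfolding G_def using F(3) by force
  ultimately obtain N where N: "\<And>n. n \<ge> N \<Longrightarrow> z (Suc n) = f (z n)"
    unfolding eventually_sequentially by auto
  obtain p M where "p > 0" "\<And>n. n \<ge> M \<Longrightarrow> z (n + p) = z n"
    using eventually_recursive_imp_eventually_periodic[of F z N f, OF F(1,3) N] by blast
  then have "convergent (\<lambda>n. (\<Sum>i<n. z i) /\<^sub>R real n)"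
    by (rule eventually_periodic_means_convergent)
  moreover have "convergent (\<lambda>n. (\<Sum>i<n. y i - z i) /\<^sub>R real n)"
    using null_sequence_means[OF lim] by (rule convergentI)
  ultimately have "convergent (\<lambda>n. (\<Sum>i<n. y i - z i) /\<^sub>R real n + (\<Sum>i<n. z i) /\<^sub>R real n)"
    by (rule convergent_add[rotated])
  then show ?thesis
    by (simp add: sum_subtractf scaleR_diff_right)
qed

section \<open>Compactness of the simplex and continuity of the operator\<close>

lemma compact_prob_simplex: "compact (prob_simplex :: (real ^ 'm) set)"
proof -
  have "closed (prob_simplex :: (real ^ 'm) set)"
    unfolding prob_simplex_def
    by (intro closed_Collect_conj closed_Collect_all closed_Collect_le closed_Collect_eq
        continuous_intros)
  moreover have "norm x \<le> 1" if "x \<in> prob_simplex" for x :: "real ^ 'm"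
    using norm_le_l1_cart[of x] that by (simp add: prob_simplex_def)
  ultimately show ?thesis
    by (auto simp: compact_eq_bounded_closed bounded_iff)
qed

lemma continuous_on_quadratic_stochastic_operator:
  assumes "quadratic_stochastic_operator V"
  shows "continuous_on prob_simplex V"
proof -
  obtain p where p: "\<And>x k. x \<in> prob_simplex \<Longrightarrow>
      V x $ k = (\<Sum>i\<in>UNIV. \<Sum>j\<in>UNIV. p i j k * x $ i * x $ j)"
    using assms unfolding quadratic_stochastic_operator_def by blast
  \<comment> \<open>The polynomial map stands in for \<open>V\<close>, with which it is only known
    to agree on the simplex.\<close>
  have "continuous_on prob_simplex (\<lambda>x. \<chi> k. \<Sum>i\<in>UNIV. \<Sum>j\<in>UNIV. p i j k * x $ i * x $ j)"
    by (intro continuous_intros)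
  then show ?thesis
    by (rule continuous_on_eq) (simp add: vec_eq_iff p)
qed

section \<open>Decreasing rearrangements and majorization\<close>

text \<open>This turns the multiset description of the rearrangement into an assignment of a rank to
  each coordinate, with ties broken arbitrarily.\<close>

lemma decreasing_rearrangement_permutes_entries:
  fixes x :: "real ^ 'm"
  obtains \<pi> where "bij_betw \<pi> (UNIV :: 'm set) {..<CARD('m)}"
    and "\<And>i. x $ i = decreasing_rearrangement x ! \<pi> i"
proof -
  obtain h where h: "bij_betw h (UNIV :: 'm set) {..<CARD('m)}"
    using ex_bij_betw_finite_nat[of "UNIV :: 'm set"] by (auto simp: lessThan_atLeast0)
  define g where "g = inv_into UNIV h"
  have g: "bij_betw g {..<CARD('m)} UNIV"
    unfolding g_def by (rule bij_betw_inv_into[OF h])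
  have gh: "g (h i) = i" for i
    unfolding g_def using h by (simp add: bij_betw_def)
  \<comment> \<open>The entries in the order of an arbitrary enumeration of the index type: a list
    with the same multiset as the rearrangement, hence a permutation of it.\<close>
  define xs where "xs = map (\<lambda>n. x $ g n) [0..<CARD('m)]"
  have "mset xs = image_mset (\<lambda>i. x $ i) (image_mset g (mset_set {..<CARD('m)}))"
    by (simp add: xs_def multiset.map_comp comp_def lessThan_atLeast0)
  also have "image_mset g (mset_set {..<CARD('m)}) = mset_set UNIV"
    using g by (simp add: image_mset_mset_set bij_betw_def)
  finally have "mset xs = mset (decreasing_rearrangement x)"
    by (simp add: mset_decreasing_rearrangement)
  then obtain q where q: "q permutes {..<length (decreasing_rearrangement x)}"
    and xs: "permute_list q (decreasing_rearrangement x) = xs"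
    by (rule mset_eq_permutation)
  have len: "length (decreasing_rearrangement x) = CARD('m)"
    by (rule length_decreasing_rearrangement)
  show thesis
  proof
    show "bij_betw (q \<circ> h) UNIV {..<CARD('m)}"
      using h permutes_imp_bij[OF q] by (auto simp: len intro: bij_betw_trans)
    fix i
    have hi: "h i < CARD('m)"
      using h by (auto simp: bij_betw_def)
    have "x $ i = xs ! h i"
      using hi by (simp add: xs_def gh)
    also have "\<dots> = decreasing_rearrangement x ! (q \<circ> h) i"
      using hi q by (simp add: xs[symmetric] permute_list_nth len)
    finally show "x $ i = decreasing_rearrangement x ! (q \<circ> h) i" .
  qed
qed

lemma prob_simplex_entry_bounds:
  assumes "x \<in> prob_simplex"
  shows "0 \<le> x $ i" "x $ i \<le> 1"
  using assms member_le_sum[of i UNIV "\<lambda>i. x $ i"] by (auto simp: prob_simplex_def)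

lemma decreasing_rearrangement_bounds:
  fixes x :: "real ^ 'm"
  assumes "x \<in> prob_simplex" "k < CARD('m)"
  shows "0 \<le> decreasing_rearrangement x ! k" "decreasing_rearrangement x ! k \<le> 1"
proof -
  obtain \<pi> where \<pi>: "bij_betw \<pi> (UNIV :: 'm set) {..<CARD('m)}"
    "\<And>i. x $ i = decreasing_rearrangement x ! \<pi> i"
    by (rule decreasing_rearrangement_permutes_entries[of x]) blast
  then have "k \<in> range \<pi>"
    using assms(2) by (simp add: bij_betw_def)
  then obtain i where "k = \<pi> i"
    by blast
  then show "0 \<le> decreasing_rearrangement x ! k" "decreasing_rearrangement x ! k \<le> 1"
    using prob_simplex_entry_bounds[OF assms(1), of i] \<pi>(2)[of i] by simp_all
qed

lemma majorized_by_partial_sums: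
  fixes x y :: "real ^ 'm"
  assumes "x \<prec>\<^sub>m y" "k \<le> CARD('m)"
  shows "(\<Sum>i<k. decreasing_rearrangement x ! i) \<le> (\<Sum>i<k. decreasing_rearrangement y ! i)"
proof -
  \<comment> \<open>The definition of majorization counts positions from 1, the list from 0.\<close>
  have shift: "(\<Sum>i=1..k. d ! (i - 1)) = (\<Sum>i<k. d ! i)" for d :: "real list" and k
    by (rule sum.reindex_bij_witness[of _ Suc "\<lambda>i. i - 1"]) auto
  consider "k = 0" | "k \<in> {1..CARD('m) - 1}" | "k = CARD('m)"
    using assms(2) by fastforce
  then show ?thesis
    using assms(1) unfolding majorized_by_def shift by cases auto
qed

text \<open>Each partial sum of the rearrangement increases along the chain and is bounded, hence
  converges; a single entry is the difference of two consecutive partial sums.\<close>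

lemma majorized_by_chain_rearrangement_convergent:
  fixes y :: "nat \<Rightarrow> real ^ 'm"
  assumes y: "\<And>n. y n \<in> prob_simplex" and chain: "\<And>n. y n \<prec>\<^sub>m y (Suc n)" and "k < CARD('m)"
  shows "convergent (\<lambda>n. decreasing_rearrangement (y n) ! k)"
proof -
  define P where "P k n = (\<Sum>i<k. decreasing_rearrangement (y n) ! i)" for k n
  have P: "convergent (P k)" if k: "k \<le> CARD('m)" for k
  proof (rule Bseq_monoseq_convergent)
    show "monoseq (P k)"
      using majorized_by_partial_sums[OF chain k] by (simp add: monoseq_Suc P_def)
    have "\<bar>P k n\<bar> \<le> (\<Sum>i<k. 1)" for n
      unfolding P_def using decreasing_rearrangement_bounds[OF y[of n]] k
      by (intro order_trans[OF sum_abs] sum_mono) auto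
    then show "Bseq (P k)"
      by (intro BseqI'[of _ "real k"]) simp
  qed
  have "convergent (\<lambda>n. P (Suc k) n - P k n)"
    using assms(3) by (intro convergent_diff P) auto
  then show ?thesis
    by (simp add: P_def)
qed

section \<open>Approximation of the orbit by permutations of the limit rearrangement\<close>

theorem theorem4p1:
  fixes V :: "real ^ 'm \<Rightarrow> real ^ 'm"
  assumes "quadratic_stochastic_operator V"
    and "dissipative V"
  shows "ergodic V"
  unfolding ergodic_def
proof
  fix x :: "real ^ 'm"
  assume x: "x \<in> prob_simplex"
  define y where "y n = (V ^^ n) x" for n
  let ?d = "\<lambda>n. decreasing_rearrangement (y n)"
  have V: "V u \<in> prob_simplex" if "u \<in> prob_simplex" for u
    using assms(1) that unfolding quadratic_stochastic_operator_def by blast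
  have y: "y n \<in> prob_simplex" for n
    by (induction n) (simp_all add: y_def x V)
  have chain: "y n \<prec>\<^sub>m y (Suc n)" for n
    using assms(2) y[of n] by (simp add: dissipative_def y_def)
  define a where "a k = lim (\<lambda>n. ?d n ! k)" for k
  have a: "(\<lambda>n. ?d n ! k) \<longlonglongrightarrow> a k" if "k < CARD('m)" for k
    using majorized_by_chain_rearrangement_convergent[of y, OF _ _ that] y chain
    by (simp add: a_def convergent_LIMSEQ_iff)
  \<comment> \<open>The ranking of the coordinates may change with \<open>n\<close>, so one is
    chosen for every \<open>n\<close>.\<close>
  have "\<forall>n. \<exists>\<pi>. bij_betw \<pi> (UNIV :: 'm set) {..<CARD('m)} \<and> (\<forall>i. y n $ i = ?d n ! \<pi> i)"
    by (meson decreasing_rearrangement_permutes_entries)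
  from choice[OF this] obtain \<pi> where \<pi>: "\<And>n. bij_betw (\<pi> n) (UNIV :: 'm set) {..<CARD('m)}"
    "\<And>n i. y n $ i = ?d n ! \<pi> n i"
    by blast
  have \<pi>_less: "\<pi> n i < CARD('m)" for n i
    using \<pi>(1)[of n] by (auto simp: bij_betw_def)
  have a_nonneg: "0 \<le> a k" if "k < CARD('m)" for k
    using decreasing_rearrangement_bounds(1)[OF y that] by (intro LIMSEQ_le_const[OF a[OF that]]) auto
  \<comment> \<open>Total mass 1 passes to the limit values \<open>a\<close>; with nonnegativity
    this places every rearrangement of \<open>a\<close> in the simplex, where \<open>V\<close> is
    continuous.\<close>
  have "(\<Sum>k<CARD('m). ?d n ! k) = (\<Sum>i\<in>UNIV. y n $ i)" for n
    using sum.reindex_bij_betw[OF \<pi>(1)[of n], of "\<lambda>k. ?d n ! k"] by (simp add: \<pi>(2))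
  then have "(\<Sum>k<CARD('m). ?d n ! k) = 1" for n
    using y[of n] by (simp add: prob_simplex_def)
  moreover have "(\<lambda>n. \<Sum>k<CARD('m). ?d n ! k) \<longlonglongrightarrow> (\<Sum>k<CARD('m). a k)"
    by (intro tendsto_sum a) simp
  ultimately have a_sum: "(\<Sum>k<CARD('m). a k) = 1"
    by (simp add: LIMSEQ_const_iff)
  \<comment> \<open>The coordinate of rank \<open>k\<close> in \<open>y n\<close> is replaced by the
    limit of the entries of rank \<open>k\<close>.\<close>
  define z where "z n = (\<chi> i. a (\<pi> n i))" for n
  have z: "z n \<in> prob_simplex" for n
    using sum.reindex_bij_betw[OF \<pi>(1)[of n], of a]
    by (simp add: prob_simplex_def z_def a_nonneg \<pi>_less a_sum)
  \<comment> \<open>Each \<open>z n\<close> is determined by a map from coordinates to ranks, and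
    there are finitely many of these.\<close>
  have "range z \<subseteq> (\<lambda>\<sigma>. \<chi> i. a (\<sigma> i)) ` (UNIV \<rightarrow>\<^sub>E {..<CARD('m)})"
    using \<pi>_less by (auto simp: z_def)
  then have fin: "finite (range z)"
    by (rule finite_subset) (simp add: finite_PiE)
  \<comment> \<open>Reindexed by rank, the l1 distance from \<open>y n\<close> to \<open>z n\<close>
    no longer involves \<open>\<pi> n\<close>, so the convergence of each rank suffices although the
    ranking varies.\<close>
  have "(\<lambda>n. \<Sum>k<CARD('m). \<bar>?d n ! k - a k\<bar>) \<longlonglongrightarrow> (\<Sum>k<CARD('m). \<bar>a k - a k\<bar>)"
    by (intro tendsto_intros a) simp
  then have "(\<lambda>n. \<Sum>k<CARD('m). \<bar>?d n ! k - a k\<bar>) \<longlonglongrightarrow> 0"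
    by simp
  moreover have "norm (y n - z n) \<le> (\<Sum>k<CARD('m). \<bar>?d n ! k - a k\<bar>)" for n
    using norm_le_l1_cart[of "y n - z n"]
      sum.reindex_bij_betw[OF \<pi>(1)[of n], of "\<lambda>k. \<bar>?d n ! k - a k\<bar>"]
    by (simp add: z_def \<pi>(2))
  ultimately have lim: "(\<lambda>n. y n - z n) \<longlonglongrightarrow> 0"
    by (intro Lim_null_comparison[of "\<lambda>n. y n - z n"] always_eventually) auto
  have "convergent (\<lambda>n. (\<Sum>i<n. y i) /\<^sub>R real n)"
    using compact_prob_simplex continuous_on_quadratic_stochastic_operator[OF assms(1)] y _ fin _ _ lim
    by (rule orbit_near_finite_set_means_convergent) (use z in \<open>auto simp: y_def\<close>)
  then show "convergent (\<lambda>n. (\<Sum>i<n. (V ^^ i) x) /\<^sub>R real n)"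
    by (simp add: y_def)
qed

end
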